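(* Let $n \ge 2$ be an integer. If there exists a multiplicative orthomorphism modulo $n$, then $n = 2$.
   Context: For an integer $n \ge 2$, a multiplicative orthomorphism modulo $n$ is a permutation $\sigma$ of $\{1, \dots, n-1\}$ such that the map $x \mapsto x\sigma(x) \bmod n$ is also a bijection of $\{1, \dots, n-1\}$ (residues taken in $\{0,\dots,n-1\}$). *)

theory Defs
  imports Main
begin

(* Only the values of sigma on {1..n-1} matter; nothing is required outside this set. *)
definition multiplicative_orthomorphism :: "nat \<Rightarrow> (nat \<Rightarrow> nat) \<Rightarrow> bool" where
  "multiplicative_orthomorphism n \<sigma> \<longleftrightarrow>
     bij_betw \<sigma> {1..n - 1} {1..n - 1} \<and>
     bij_betw (\<lambda>x. (x * \<sigma> x) mod n) {1..n - 1} {1..n - 1}"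

end

theory Submission
  imports Defs "HOL-Number_Theory.Residues"
begin

text \<open>
  Let \<open>\<theta> x = x * \<sigma> x mod n\<close> and let \<open>d\<close> divide \<open>n\<close>. As \<open>\<theta>\<close> maps the nonzero multiples of \<open>d\<close>
  injectively into themselves, it permutes them; hence \<open>d dvd \<sigma> x\<close>, which gives \<open>d dvd \<theta> x\<close>,
  forces \<open>d dvd x\<close>, and by counting \<open>\<sigma>\<close> permutes the nonzero multiples of \<open>d\<close> too. Now take
  \<open>d = n / p\<close> for a prime \<open>p\<close>. If \<open>p dvd d\<close>, then \<open>\<theta> d = 0\<close>, which is impossible. Otherwise the
  product \<open>P\<close> of \<open>d, 2 * d, \<dots>, (p - 1) * d\<close> satisfies \<open>P * P = P\<close> modulo \<open>p\<close>, while \<open>P = -1\<close>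
  by the theorems of Fermat and Wilson. So \<open>p = 2\<close>: every prime factor of \<open>n\<close> is 2, and 4 does
  not divide \<open>n\<close>.
\<close>

definition nonzero_multiples :: "nat \<Rightarrow> nat \<Rightarrow> nat set" where
  "nonzero_multiples n d = {x \<in> {1..n - 1}. d dvd x}"

lemma finite_nonzero_multiples [simp]: "finite (nonzero_multiples n d)"
  by (simp add: nonzero_multiples_def)

lemma nonzero_multiples_mult:
  assumes "d > 0"
  shows "nonzero_multiples (p * d) d = (\<lambda>k. k * d) ` {1..p - 1}"
proof -
  have bounds: "(1 \<le> k * d \<and> k * d \<le> p * d - 1) \<longleftrightarrow> (1 \<le> k \<and> k \<le> p - 1)" for k
  \<comment> \<open>For \<open>p = 0\<close>, truncated subtraction makes both ranges empty. For
    positive \<open>p\<close> the upper bound means \<open>k * d < p * d\<close>, and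
    \<open>d\<close> cancels.\<close>
  proof (cases "k = 0 \<or> p = 0")
    case False
    then have "(k * d \<le> p * d - 1) \<longleftrightarrow> k * d < p * d"
      using assms by (metis Suc_pred' less_Suc_eq_le mult_pos_pos neq0_conv)
    with False assms show ?thesis by auto
  qed auto
  have "x \<in> nonzero_multiples (p * d) d \<longleftrightarrow> (\<exists>k. x = k * d \<and> k * d \<in> {1..p * d - 1})" for x
    unfolding nonzero_multiples_def dvd_def mult.commute[of d] by blast
  then show ?thesis
    unfolding atLeastAtMost_iff bounds by (simp add: set_eq_iff image_iff Bex_def conj_ac)
qed

lemma product_image_nonzero_multiples:
  assumes "multiplicative_orthomorphism n \<sigma>" and "d dvd n"
  shows "bij_betw (\<lambda>x. (x * \<sigma> x) mod n) (nonzero_multiples n d) (nonzero_multiples n d)"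
proof -
  let ?\<theta> = "\<lambda>x. (x * \<sigma> x) mod n"
  have bij: "bij_betw ?\<theta> {1..n - 1} {1..n - 1}"
    using assms(1) by (simp add: multiplicative_orthomorphism_def)
  have inj: "inj_on ?\<theta> (nonzero_multiples n d)"
    using bij by (rule inj_on_subset[OF bij_betw_imp_inj_on])
      (auto simp: nonzero_multiples_def)
  \<comment> \<open>Reduction modulo \<open>n\<close> keeps divisibility by \<open>d\<close> because
    \<open>d\<close> divides \<open>n\<close>.\<close>
  have "?\<theta> x \<in> nonzero_multiples n d" if "x \<in> nonzero_multiples n d" for x
    using that bij_betwE[OF bij] assms(2)
    by (simp add: nonzero_multiples_def dvd_mod)
  then have "?\<theta> ` nonzero_multiples n d = nonzero_multiples n d"
    by (intro endo_inj_surj inj) auto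
  with inj show ?thesis by (simp add: bij_betw_def)
qed

lemma orthomorphism_nonzero_multiples:
  assumes "multiplicative_orthomorphism n \<sigma>" and "d dvd n"
  shows "bij_betw \<sigma> (nonzero_multiples n d) (nonzero_multiples n d)"
proof -
  let ?\<theta> = "\<lambda>x. (x * \<sigma> x) mod n" and ?M = "nonzero_multiples n d"
  have bij: "bij_betw \<sigma> {1..n - 1} {1..n - 1}" "bij_betw ?\<theta> {1..n - 1} {1..n - 1}"
    using assms(1) by (simp_all add: multiplicative_orthomorphism_def)
  have sub: "?M \<subseteq> {1..n - 1}"
    by (auto simp: nonzero_multiples_def)
  have inj: "inj_on \<sigma> ?M"
    using inj_on_subset[OF bij_betw_imp_inj_on[OF bij(1)] sub] .
  \<comment> \<open>From \<open>d dvd x\<close> nothing follows directly about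
    \<open>\<sigma> x\<close>, so the argument starts from a value \<open>y\<close> in
    \<open>?M\<close> and looks at its preimage.\<close>
  have "?M \<subseteq> \<sigma> ` ?M"
  proof
    fix y assume y: "y \<in> ?M"
    then obtain x where x: "x \<in> {1..n - 1}" "y = \<sigma> x"
      using bij_betw_imp_surj_on[OF bij(1)] sub by blast
    have "?\<theta> x \<in> ?M"
      using y x bij_betwE[OF bij(2)] assms(2)
      by (simp add: nonzero_multiples_def dvd_mod)
    then obtain x' where "x' \<in> ?M" "?\<theta> x' = ?\<theta> x"
      using bij_betw_imp_surj_on[OF product_image_nonzero_multiples[OF assms]] by force
    \<comment> \<open>The product map is injective on the whole range, so
      \<open>x = x'\<close>.\<close>
    then have "x \<in> ?M"
      using inj_onD[OF bij_betw_imp_inj_on[OF bij(2)]] x(1) sub by blast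
    with x show "y \<in> \<sigma> ` ?M" by blast
  qed
  then have "\<sigma> ` ?M = ?M"
    by (metis card_image card_seteq finite_imageI finite_nonzero_multiples inj order_refl)
  with inj show ?thesis by (simp add: bij_betw_def)
qed

lemma orthomorphism_prime_cofactor:
  assumes orth: "multiplicative_orthomorphism (p * d) \<sigma>" and "prime p" and "d > 0"
  shows "\<not> p dvd d"
proof
  assume "p dvd d"
  have "p \<ge> 2" using \<open>prime p\<close> by (rule prime_ge_2_nat)
  then have d: "d \<in> nonzero_multiples (p * d) d"
    using \<open>d > 0\<close> by (auto simp: nonzero_multiples_mult image_iff intro!: bexI[of _ 1])
  have "d dvd \<sigma> d"
    using bij_betwE[OF orthomorphism_nonzero_multiples[OF orth dvd_triv_right]] d
    by (simp add: nonzero_multiples_def)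
  \<comment> \<open>\<open>d * \<sigma> d\<close> is a multiple of \<open>d * d\<close>, hence of
    \<open>p * d\<close> since \<open>p\<close> divides \<open>d\<close>.\<close>
  then have "(d * \<sigma> d) mod (p * d) = 0"
    using \<open>p dvd d\<close> by (metis dvd_imp_mod_0 dvd_trans mult.commute mult_dvd_mono dvd_refl)
  moreover have "(d * \<sigma> d) mod (p * d) \<in> nonzero_multiples (p * d) d"
    using bij_betwE[OF product_image_nonzero_multiples[OF orth dvd_triv_right]] d by blast
  ultimately show False by (simp add: nonzero_multiples_def)
qed

text \<open>The product splits into \<open>(p - 1)!\<close>, evaluated by Wilson, and
  \<open>d ^ (p - 1)\<close>, evaluated by Fermat since \<open>p\<close> does not divide
  \<open>d\<close>.\<close>

lemma prod_nonzero_multiples_cong: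
  fixes p d :: nat
  assumes "prime p" and "\<not> p dvd d"
  shows "[int (\<Prod>(nonzero_multiples (p * d) d)) = - 1] (mod int p)"
proof -
  have "d > 0" using assms(2) by (auto intro: gr0I)
  have "\<Prod>(nonzero_multiples (p * d) d) = (\<Prod>k\<in>{1..p - 1}. k * d)"
    using \<open>d > 0\<close> by (simp add: nonzero_multiples_mult prod.reindex inj_on_def)
  also have "\<dots> = fact (p - 1) * d ^ (p - 1)"
    by (simp add: prod.distrib fact_prod)
  finally have eq: "int (\<Prod>(nonzero_multiples (p * d) d)) = fact (p - 1) * int (d ^ (p - 1))"
    by simp
  have "[int (d ^ (p - 1)) = int 1] (mod int p)"
    using fermat_theorem[OF assms] by (simp only: cong_int_iff)
  from cong_mult[OF wilson_theorem[OF assms(1)] this] show ?thesis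
    unfolding eq by simp
qed

lemma orthomorphism_prime_eq_2:
  assumes orth: "multiplicative_orthomorphism (p * d) \<sigma>" and "prime p" and "d > 0"
  shows "p = 2"
proof -
  let ?M = "nonzero_multiples (p * d) d" and ?P = "int (\<Prod>(nonzero_multiples (p * d) d))"
  note dvd = dvd_triv_right[of d p]
  \<comment> \<open>Reducing modulo \<open>p * d\<close> changes nothing modulo \<open>p\<close>.
    Reindexing along the two permutations of \<open>?M\<close> then turns the sides into
    \<open>P\<close> and \<open>P * P\<close>.\<close>
  have "[(\<Prod>x\<in>?M. (x * \<sigma> x) mod (p * d)) = (\<Prod>x\<in>?M. x * \<sigma> x)] (mod p)"
    by (intro cong_prod) (simp add: cong_def mod_mult_right_eq mod_mod_cancel)
  moreover have "(\<Prod>x\<in>?M. (x * \<sigma> x) mod (p * d)) = \<Prod>?M"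
    using prod.reindex_bij_betw[OF product_image_nonzero_multiples[OF orth dvd], of id] by simp
  moreover have "(\<Prod>x\<in>?M. x * \<sigma> x) = \<Prod>?M * \<Prod>?M"
    using prod.reindex_bij_betw[OF orthomorphism_nonzero_multiples[OF orth dvd], of id]
    by (simp add: prod.distrib)
  ultimately have idem: "[?P = ?P * ?P] (mod int p)"
    by (metis cong_int_iff of_nat_mult)
  have P: "[?P = - 1] (mod int p)"
    using prod_nonzero_multiples_cong \<open>prime p\<close> orthomorphism_prime_cofactor[OF assms] by blast
  have "[- 1 = 1] (mod int p)"
    using cong_trans[OF cong_trans[OF cong_sym[OF P] idem] cong_mult[OF P P]] by simp
  then have "int p dvd 2"
    by (simp add: cong_iff_dvd_diff)
  then have "p dvd 2"
    by presburger
  with \<open>prime p\<close> show ?thesis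
    using primes_dvd_imp_eq two_is_prime_nat by blast
qed

theorem theorem1p3:
  fixes n :: nat
  assumes "n \<ge> 2"
    and "\<exists>\<sigma>. multiplicative_orthomorphism n \<sigma>"
  shows "n = 2"
proof -
  obtain \<sigma> where \<sigma>: "multiplicative_orthomorphism n \<sigma>"
    using assms(2) by blast
  have prime_2: "p = 2 \<and> \<not> 2 dvd n div 2" if "prime p" "p dvd n" for p
  proof -
    obtain d where n: "n = p * d" using \<open>p dvd n\<close> by blast
    then have "d > 0" using assms(1) by (auto intro: gr0I)
    show ?thesis
      using orthomorphism_prime_eq_2[OF \<sigma>[unfolded n] \<open>prime p\<close> \<open>d > 0\<close>]
        orthomorphism_prime_cofactor[OF \<sigma>[unfolded n] \<open>prime p\<close> \<open>d > 0\<close>] n by simp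
  qed
  obtain p where "prime p" "p dvd n"
    using prime_factor_nat[of n] assms(1) by auto
  then have n: "n = 2 * (n div 2)" and odd: "\<not> 2 dvd n div 2"
    using prime_2 by auto
  have "n div 2 = 1"
  proof (rule ccontr)
    assume "n div 2 \<noteq> 1"
    then obtain q where "prime q" "q dvd n div 2"
      using prime_factor_nat by blast
    \<comment> \<open>\<open>q\<close> also divides \<open>n\<close>, so \<open>q = 2\<close>,
      although \<open>n div 2\<close> is odd.\<close>
    with prime_2[of q] odd show False
      by (metis dvd_mult n)
  qed
  with n show ?thesis by simp
qed

end
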